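(* For all positive integers $n$ the following hold: (i) $\binom{C(2,n)}{2} \le \left\lfloor \frac n2 \right\rfloor$, and in particular $C(2,n)\le \sqrt{n}+1$; (ii) $C(3,n) \le \sqrt{n+9/2}+3$; (iii) $C(4,n) \le \sqrt{3n} + 7/6$; (iv) $C(g,n) \le \sqrt{gn}$ for every even positive integer $g$; (v) $C(g,n) \le \sqrt{1-\tfrac1g}\,\sqrt{gn}+1$ for every odd positive integer $g$.
   Context: $\mathbb{Z}_n$ denotes the integers modulo $n$. For a set $S\subseteq\mathbb{Z}_n$ and $k\in\mathbb{Z}_n$, let $S\ast S(k)=|\{(s_1,s_2): s_1,s_2\in S,\ s_1+s_2=k\}|$ be the number of ordered pairs of elements of $S$ with sum $k$ (addition in $\mathbb{Z}_n$), and let $\|S\ast S\|_\infty=\max_{k\in\mathbb{Z}_n} S\ast S(k)$. For positive integers $g,n$, define $C(g,n)=\max\{|S| : S\subseteq\mathbb{Z}_n,\ \|S\ast S\|_\infty\le g\}$. *)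

theory Defs
  imports Complex_Main "HOL-Algebra.Elementary_Groups"
begin

text \<open>The library group \<^const>\<open>integer_mod_group\<close> is written multiplicatively: its operation is
  addition of the representatives \<open>0, \<dots>, n - 1\<close> modulo \<open>n\<close>.\<close>

definition sum_rep :: "nat \<Rightarrow> int set \<Rightarrow> int \<Rightarrow> nat" where
  "sum_rep n S k = card {(s1, s2). s1 \<in> S \<and> s2 \<in> S \<and> s1 \<otimes>\<^bsub>integer_mod_group n\<^esub> s2 = k}"

definition sum_rep_max :: "nat \<Rightarrow> int set \<Rightarrow> nat" where
  "sum_rep_max n S = Max (sum_rep n S ` carrier (integer_mod_group n))"

text \<open>Used for \<open>n > 0\<close> only: \<^term>\<open>integer_mod_group 0\<close> is the infinite group of integers.\<close>

definition C :: "nat \<Rightarrow> nat \<Rightarrow> nat" where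
  "C g n = Max {card S | S. S \<subseteq> carrier (integer_mod_group n) \<and> sum_rep_max n S \<le> g}"

end

theory Submission
  imports Defs "HOL-Analysis.Convex"
begin

text \<open>
  Write \<open>m = |S|\<close>, and let \<open>S\<close> have at most \<open>g\<close> representations of every sum.

  The bound \<open>m\<^sup>2 \<le> g n\<close> counts \<open>S \<times> S\<close> by sums. The other bounds compare sums with
  differences: let \<open>r d\<close> be the number of ways to write \<open>d\<close> as a difference of two elements
  of \<open>S\<close>, so that \<open>r 0 = m\<close> and the sum of \<open>r d\<close> over \<open>d \<noteq> 0\<close> is \<open>m (m - 1)\<close>.

  \<^bold>\<open>All \<open>g\<close>.\<close> Since \<open>a + b = c + e\<close> is equivalent to \<open>a - c = e - b\<close>, the sums and the
  differences have the same second moment (\<open>additive_energy\<close>). For the sums it is at most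
  \<open>g m\<^sup>2\<close>, and \<open>d = 0\<close> contributes \<open>m\<^sup>2\<close> to it, so \<open>d \<noteq> 0\<close> contributes at most
  \<open>(g - 1) m\<^sup>2\<close>. Cauchy--Schwarz over the \<open>n - 1\<close> differences \<open>d \<noteq> 0\<close> gives
  \<open>m\<^sup>2 (m - 1)\<^sup>2 \<le> (n - 1) (g - 1) m\<^sup>2\<close>, that is \<open>(m - 1)\<^sup>2 \<le> (g - 1) (n - 1)\<close> if \<open>m > 0\<close>
  (\<open>card_le_sqrt_energy\<close>). This gives the square root bounds for \<open>g = 2\<close>, \<open>g = 4\<close> and odd \<open>g\<close>.

  \<^bold>\<open>Small \<open>g\<close>.\<close> If \<open>x, x + d, y, y + d\<close> all lie in \<open>S\<close>, then \<open>x + y + d\<close> has at least as many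
  representations as there are distinct elements among these four
  (\<open>card_translates_le_sum_rep\<close>). For \<open>g = 2\<close> this forces \<open>r d \<le> 1\<close> for \<open>d \<noteq> 0\<close>, except that
  \<open>r (n/2) \<le> 2\<close>, so \<open>m (m - 1) \<le> 2 \<lfloor>n/2\<rfloor>\<close>. For \<open>g = 3\<close> any two pairs in \<open>S\<close> with the same
  difference \<open>d \<noteq> 0\<close> share an element, which is then the middle of a three-term progression in
  \<open>S\<close>; so \<open>r d - 1\<close> is at most the number of such middles. Each \<open>s \<in> S\<close> is a middle for at
  most two \<open>d \<noteq> 0\<close>, because \<open>(s + d) + (s - d)\<close> always represents \<open>2 s\<close>, as does
  \<open>s + s\<close>. Therefore \<open>m (m - 1) \<le> n - 1 + 2 m\<close>.
\<close>

section \<open>Differences, midpoints and extremal sets\<close>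

text \<open>The elements of \<open>S\<close> whose translate by \<open>d\<close> modulo \<open>n\<close> is again in \<open>S\<close>. For \<open>S\<close> within
  the residues \<open>0, \<dots>, n - 1\<close> their number is the number of representations of \<open>d\<close> as a difference.\<close>

definition shift_meet :: "nat \<Rightarrow> int set \<Rightarrow> int \<Rightarrow> int set" where
  "shift_meet n S d = {x \<in> S. (x + d) mod int n \<in> S}"

text \<open>The middle terms of the progressions \<open>x - d, x, x + d\<close> modulo \<open>n\<close> that lie in \<open>S\<close>.
  The three terms need not be distinct: \<open>2 d\<close> may vanish modulo \<open>n\<close>.\<close>

definition midpoints :: "nat \<Rightarrow> int set \<Rightarrow> int \<Rightarrow> int set" where
  "midpoints n S d = {x \<in> S. (x + d) mod int n \<in> S \<and> (x - d) mod int n \<in> S}"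

lemma sum_rep_eq:
  assumes "n > 0"
  shows "sum_rep n S k = card {p \<in> S \<times> S. (fst p + snd p) mod int n = k}"
proof -
  have "{(s1, s2). s1 \<in> S \<and> s2 \<in> S \<and> s1 \<otimes>\<^bsub>integer_mod_group n\<^esub> s2 = k}
      = {p \<in> S \<times> S. (fst p + snd p) mod int n = k}"
    by auto
  then show ?thesis by (simp add: sum_rep_def)
qed

lemma C_attained:
  assumes n: "n > 0"
  obtains S where "S \<subseteq> {0..<int n}" "card S = C g n" "\<And>k. k \<in> {0..<int n} \<Longrightarrow> sum_rep n S k \<le> g"
proof -
  let ?F = "{S. S \<subseteq> {0..<int n} \<and> sum_rep_max n S \<le> g}"
  have car: "carrier (integer_mod_group n) = {0..<int n}"
    using n by (simp add: carrier_integer_mod_group)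
  have C: "C g n = Max (card ` ?F)"
    unfolding C_def car by (rule arg_cong[of _ _ Max]) auto
  have "finite ?F"
    by (rule finite_subset[of _ "Pow {0..<int n}"]) auto
  moreover have "{} \<in> ?F"
  proof -
    have "sum_rep n {} ` {0..<int n} = {0}"
      using n by (simp add: sum_rep_def image_constant_conv)
    then show ?thesis by (simp add: sum_rep_max_def car)
  qed
  ultimately have "Max (card ` ?F) \<in> card ` ?F"
    by (intro Max_in) auto
  then obtain S where S: "S \<subseteq> {0..<int n}" "sum_rep_max n S \<le> g" "card S = C g n"
    using C by auto
  have "sum_rep n S k \<le> g" if "k \<in> {0..<int n}" for k
  proof -
    have "sum_rep n S k \<le> sum_rep_max n S"
      unfolding sum_rep_max_def car using that by (intro Max_ge) auto
    with S(2) show ?thesis by simp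
  qed
  with S that show thesis by blast
qed

text \<open>The second moment of the fibre sizes counts the pairs of points in a common fibre.\<close>

lemma sum_card_fibres_sq:
  assumes "finite A" "finite B" "h ` A \<subseteq> B"
  shows "(\<Sum>b\<in>B. (card {a \<in> A. h a = b})\<^sup>2) = card {p \<in> A \<times> A. h (fst p) = h (snd p)}"
proof -
  have "{p \<in> A \<times> A. h (fst p) = h (snd p)}
      = (\<Union>b\<in>B. {a \<in> A. h a = b} \<times> {a \<in> A. h a = b})"
    using assms(3) by auto
  also have "card \<dots> = (\<Sum>b\<in>B. card ({a \<in> A. h a = b} \<times> {a \<in> A. h a = b}))"
    using assms by (intro card_UN_disjoint) auto
  finally show ?thesis by (simp add: card_cartesian_product power2_eq_square)
qed

lemma sum_card_fibres:
  assumes "finite A" "finite B" "h ` A \<subseteq> B"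
  shows "(\<Sum>b\<in>B. card {a \<in> A. h a = b}) = card A"
  using sum.group[OF assms, of "\<lambda>_. 1 :: nat"] by simp

section \<open>Counting sums and differences\<close>

text \<open>A set of residues modulo \<open>n > 0\<close>, each given by its representative in \<open>0, \<dots>, n - 1\<close>.\<close>

locale residue_set =
  fixes n :: nat and S :: "int set"
  assumes n_pos: "n > 0" and S_sub: "S \<subseteq> {0..<int n}"
begin

lemma finite_S [simp]: "finite S"
  using S_sub finite_subset by blast

lemma mod_S [simp]: "x \<in> S \<Longrightarrow> x mod int n = x"
  using S_sub by auto

lemma mod_range: "x mod int n \<in> {0..<int n}"
  using n_pos by simp

lemma S_mod_iff: "x \<in> S \<Longrightarrow> y \<in> S \<Longrightarrow> x = y \<longleftrightarrow> int n dvd x - y"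
  by (metis mod_S mod_eq_dvd_iff)

lemma finite_shift_meet [simp]: "finite (shift_meet n S d)"
  by (simp add: shift_meet_def)

lemma sum_sum_rep: "(\<Sum>k\<in>{0..<int n}. sum_rep n S k) = (card S)\<^sup>2"
proof -
  have "(\<Sum>k\<in>{0..<int n}. card {p \<in> S \<times> S. (fst p + snd p) mod int n = k}) = card (S \<times> S)"
    by (rule sum_card_fibres) (auto simp: n_pos)
  then show ?thesis
    by (simp add: sum_rep_eq[OF n_pos] card_cartesian_product power2_eq_square)
qed

lemma card_shift_meet:
  assumes "d \<in> {0..<int n}"
  shows "card (shift_meet n S d) = card {p \<in> S \<times> S. (snd p - fst p) mod int n = d}"
proof (rule bij_betw_same_card[of "\<lambda>x. (x, (x + d) mod int n)"])
  have d: "d mod int n = d" using assms by simp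
  show "bij_betw (\<lambda>x. (x, (x + d) mod int n)) (shift_meet n S d)
          {p \<in> S \<times> S. (snd p - fst p) mod int n = d}"
    by (rule bij_betw_byWitness[where f' = fst])
       (use d in \<open>auto simp: shift_meet_def mod_simps\<close>)
qed

lemma sum_card_shift_meet:
  "(\<Sum>d\<in>{0..<int n}. card (shift_meet n S d)) = (card S)\<^sup>2"
proof -
  have "(\<Sum>d\<in>{0..<int n}. card {p \<in> S \<times> S. (snd p - fst p) mod int n = d}) = card (S \<times> S)"
    by (rule sum_card_fibres) (auto simp: n_pos)
  then show ?thesis
    by (simp add: card_shift_meet card_cartesian_product power2_eq_square)
qed

lemma shift_meet_0: "shift_meet n S 0 = S"
  by (auto simp: shift_meet_def)

lemma split_0: "{0..<int n} = insert 0 {1..<int n}"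
  using n_pos by auto

lemma sum_card_shift_meet_nonzero:
  "(\<Sum>d\<in>{1..<int n}. card (shift_meet n S d)) + card S = (card S)\<^sup>2"
  using sum_card_shift_meet by (simp add: split_0 shift_meet_0)

lemma additive_energy:
  "(\<Sum>k\<in>{0..<int n}. (sum_rep n S k)\<^sup>2) = (\<Sum>d\<in>{0..<int n}. (card (shift_meet n S d))\<^sup>2)"
proof -
  let ?Q = "(S \<times> S) \<times> (S \<times> S)"
  let ?P = "{q \<in> ?Q. (fst (fst q) + snd (fst q)) mod int n = (fst (snd q) + snd (snd q)) mod int n}"
  let ?D = "{q \<in> ?Q. (snd (fst q) - fst (fst q)) mod int n = (snd (snd q) - fst (snd q)) mod int n}"
  have "(\<Sum>k\<in>{0..<int n}. (sum_rep n S k)\<^sup>2) = card ?P"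
    unfolding sum_rep_eq[OF n_pos] by (rule sum_card_fibres_sq) (auto simp: n_pos)
  also have "\<dots> = card ?D"
  proof (rule bij_betw_same_card)
    have eq: "(a + b) mod int n = (c + e) mod int n \<longleftrightarrow> (a - c) mod int n = (e - b) mod int n" for a b c e :: int
      by (simp add: mod_eq_dvd_iff algebra_simps)
    \<comment> \<open>pair each summand of one side with a summand of the other\<close>
    show "bij_betw (\<lambda>((a, b), (c, e)). ((c, a), (b, e))) ?P ?D"
      by (rule bij_betw_byWitness[where f' = "\<lambda>((c, a), (b, e)). ((a, b), (c, e))"])
         (auto simp: eq)
  qed
  also have "\<dots> = (\<Sum>d\<in>{0..<int n}. (card {p \<in> S \<times> S. (snd p - fst p) mod int n = d})\<^sup>2)"
    by (rule sum_card_fibres_sq[symmetric]) (auto simp: n_pos)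
  also have "\<dots> = (\<Sum>d\<in>{0..<int n}. (card (shift_meet n S d))\<^sup>2)"
    by (simp add: card_shift_meet)
  finally show ?thesis .
qed

lemma card_sq_le:
  assumes "\<And>k. k \<in> {0..<int n} \<Longrightarrow> sum_rep n S k \<le> g"
  shows "(card S)\<^sup>2 \<le> g * n"
  using sum_bounded_above[of "{0..<int n}" "sum_rep n S" g] assms
  by (simp add: sum_sum_rep mult.commute)

lemma card_le_sqrt_energy:
  assumes g: "\<And>k. k \<in> {0..<int n} \<Longrightarrow> sum_rep n S k \<le> g" and "g > 0"
  shows "real (card S) \<le> sqrt ((real g - 1) * (real n - 1)) + 1"
proof (cases "card S = 0")
  case True
  have "0 \<le> (real g - 1) * (real n - 1)" using \<open>g > 0\<close> n_pos by simp
  then show ?thesis using True by simp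
next
  case False
  define m where "m = real (card S)"
  define E where "E = (\<Sum>d\<in>{1..<int n}. (real (card (shift_meet n S d)))\<^sup>2)"
  have m: "m > 0" unfolding m_def using False by linarith
  have "(\<Sum>k\<in>{0..<int n}. (sum_rep n S k)\<^sup>2) \<le> (\<Sum>k\<in>{0..<int n}. g * sum_rep n S k)"
    using g by (intro sum_mono) (simp add: power2_eq_square)
  also have "\<dots> = g * (card S)\<^sup>2"
    by (simp add: sum_sum_rep flip: sum_distrib_left)
  finally have "(card S)\<^sup>2 + (\<Sum>d\<in>{1..<int n}. (card (shift_meet n S d))\<^sup>2) \<le> g * (card S)\<^sup>2"
    unfolding additive_energy by (simp add: split_0 shift_meet_0)
  then have "real ((card S)\<^sup>2 + (\<Sum>d\<in>{1..<int n}. (card (shift_meet n S d))\<^sup>2)) \<le> real (g * (card S)\<^sup>2)"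
    by (simp only: of_nat_le_iff)
  then have E: "E \<le> (real g - 1) * m\<^sup>2"
    by (simp add: E_def m_def algebra_simps)
  have "m * (m - 1) = (\<Sum>d\<in>{1..<int n}. real (card (shift_meet n S d)))"
    using arg_cong[OF sum_card_shift_meet_nonzero, of real]
    by (simp add: m_def power2_eq_square algebra_simps)
  then have "(m * (m - 1))\<^sup>2 \<le> E * (real n - 1)"
    using sum_squared_le_sum_of_squares[of "\<lambda>d. real (card (shift_meet n S d))" "{1..<int n}"] n_pos
    by (simp add: E_def of_nat_diff mult.commute)
  also have "\<dots> \<le> (real g - 1) * m\<^sup>2 * (real n - 1)"
    using E n_pos by (intro mult_right_mono) auto
  finally have "m\<^sup>2 * (m - 1)\<^sup>2 \<le> m\<^sup>2 * ((real g - 1) * (real n - 1))"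
    by (simp add: power_mult_distrib mult_ac)
  then have "(m - 1)\<^sup>2 \<le> (real g - 1) * (real n - 1)" using m by simp
  then have "m - 1 \<le> sqrt ((real g - 1) * (real n - 1))" by (rule real_le_rsqrt)
  then show ?thesis by (simp add: m_def)
qed

section \<open>At most two or three representations\<close>

text \<open>Each of the four elements is a first summand in some representation of \<open>x + y + d\<close>, because
  \<open>x + (y + d) = y + (x + d)\<close>. The four need not be distinct.\<close>

lemma card_translates_le_sum_rep:
  assumes x: "x \<in> shift_meet n S d" and y: "y \<in> shift_meet n S d"
  shows "card {x, y, (x + d) mod int n, (y + d) mod int n} \<le> sum_rep n S ((x + y + d) mod int n)"
proof -
  let ?x = "(x + d) mod int n" and ?y = "(y + d) mod int n"
  let ?R = "{p \<in> S \<times> S. (fst p + snd p) mod int n = (x + y + d) mod int n}"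
  have mem: "x \<in> S" "y \<in> S" "?x \<in> S" "?y \<in> S"
    using x y by (auto simp: shift_meet_def)
  have "{x, y, ?x, ?y} = fst ` {(x, ?y), (y, ?x), (?x, y), (?y, x)}"
    by auto
  also have "card \<dots> \<le> card {(x, ?y), (y, ?x), (?x, y), (?y, x)}"
    by (intro card_image_le) simp
  also have "\<dots> \<le> card ?R"
    using mem by (intro card_mono) (auto simp: mod_simps algebra_simps)
  finally show ?thesis by (simp add: sum_rep_eq[OF n_pos])
qed

lemma translate_neq:
  assumes "x \<in> S" "d \<in> {1..<int n}"
  shows "(x + d) mod int n \<noteq> x"
proof
  assume "(x + d) mod int n = x"
  then have "(x + d) mod int n = x mod int n" using assms by simp
  then have "int n dvd d" by (simp add: mod_eq_dvd_iff)
  with assms(2) show False by (auto dest: zdvd_imp_le)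
qed

lemma translate_inj:
  assumes "x \<in> S" "y \<in> S" "(x + d) mod int n = (y + d) mod int n"
  shows "x = y"
  using assms by (simp add: S_mod_iff mod_eq_dvd_iff)

lemma card_shift_meet_le_2:
  assumes f: "\<And>k. k \<in> {0..<int n} \<Longrightarrow> sum_rep n S k \<le> 2" and d: "d \<in> {1..<int n}"
  shows "card (shift_meet n S d) \<le> (if 2 * d = int n then 2 else 1)"
proof (cases "\<exists>x y. x \<in> shift_meet n S d \<and> y \<in> shift_meet n S d \<and> x \<noteq> y")
  case False
  then have "card (shift_meet n S d) \<le> 1"
    by (auto simp: card_le_Suc0_iff_eq)
  then show ?thesis by simp
next
  case True
  have swap: "y = (x + d) mod int n"
    if x: "x \<in> shift_meet n S d" and y: "y \<in> shift_meet n S d" and "x \<noteq> y" for x y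
  proof (rule ccontr)
    assume y_neq: "y \<noteq> (x + d) mod int n"
    have S: "x \<in> S" "y \<in> S" using x y by (auto simp: shift_meet_def)
    have "card {x, y, (x + d) mod int n} = 3"
      using \<open>x \<noteq> y\<close> y_neq translate_neq[OF S(1) d] by auto
    then have "3 \<le> card {x, y, (x + d) mod int n, (y + d) mod int n}"
      using card_mono[of "{x, y, (x + d) mod int n, (y + d) mod int n}" "{x, y, (x + d) mod int n}"]
      by auto
    also have "\<dots> \<le> sum_rep n S ((x + y + d) mod int n)"
      by (rule card_translates_le_sum_rep[OF x y])
    also have "\<dots> \<le> 2" by (rule f[OF mod_range])
    finally show False by simp
  qed
  from True obtain x y where xy: "x \<in> shift_meet n S d" "y \<in> shift_meet n S d" "x \<noteq> y" by blast
  have "shift_meet n S d \<subseteq> {x, y}"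
  proof
    fix z assume "z \<in> shift_meet n S d"
    then show "z \<in> {x, y}" using swap[OF xy(1)] swap[OF xy] by blast
  qed
  then have "card (shift_meet n S d) \<le> card {x, y}" by (intro card_mono) auto
  \<comment> \<open>translation by \<open>d\<close> swaps \<open>x\<close> and \<open>y\<close>, so \<open>2 d\<close> vanishes modulo \<open>n\<close>\<close>
  moreover have "2 * d = int n"
  proof -
    have "x mod int n = ((x + d) mod int n + d) mod int n"
      unfolding swap[OF xy, symmetric] using swap[OF xy(2,1)] xy by (simp add: shift_meet_def)
    then have "((x + d) + d) mod int n = x mod int n" by (simp only: mod_add_left_eq)
    then have "int n dvd 2 * d" unfolding mod_eq_dvd_iff by (simp add: algebra_simps)
    then obtain c where c: "2 * d = int n * c" by blast
    have "0 < int n * c" "int n * c < int n * 2" unfolding c[symmetric] using d by auto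
    then have "0 < c" using n_pos by (simp add: zero_less_mult_iff)
    moreover have "c < 2" using \<open>int n * c < int n * 2\<close> by (rule mult_left_less_imp_less) simp
    ultimately have "c = 1" by simp
    with c show ?thesis by simp
  qed
  ultimately show ?thesis using xy by simp
qed

lemma choose_2_le:
  assumes f: "\<And>k. k \<in> {0..<int n} \<Longrightarrow> sum_rep n S k \<le> 2"
  shows "card S choose 2 \<le> n div 2"
proof -
  have "(\<Sum>d\<in>{1..<int n}. card (shift_meet n S d)) \<le> (\<Sum>d\<in>{1..<int n}. 1 + of_bool (2 * d = int n))"
    using card_shift_meet_le_2[OF f] by (intro sum_mono) fastforce
  also have "\<dots> = (n - 1) + card {d \<in> {1..<int n}. 2 * d = int n}"
    unfolding sum.distrib by (simp add: sum_of_bool_eq Int_def)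
  also have "\<dots> \<le> 2 * (n div 2)"
  proof (cases "even n")
    case True
    have "card {d \<in> {1..<int n}. 2 * d = int n} \<le> card {int n div 2}"
      by (intro card_mono) auto
    with True n_pos show ?thesis by auto
  next
    case False
    then have "2 * d \<noteq> int n" for d by presburger
    with False show ?thesis by simp
  qed
  finally have "card S * (card S - 1) \<le> 2 * (n div 2)"
    using sum_card_shift_meet_nonzero by (simp add: power2_eq_square diff_mult_distrib2)
  then show ?thesis by (simp add: choose_two)
qed

lemma card_shift_meet_le_midpoints:
  assumes f: "\<And>k. k \<in> {0..<int n} \<Longrightarrow> sum_rep n S k \<le> 3" and d: "d \<in> {1..<int n}"
  shows "card (shift_meet n S d) \<le> 1 + card (midpoints n S d)"
proof (cases "shift_meet n S d = {}")
  case False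
  then obtain x where x: "x \<in> shift_meet n S d" by blast
  have xS: "x \<in> S" "(x + d) mod int n \<in> S" using x by (auto simp: shift_meet_def)
  have adj: "y = (x + d) mod int n \<or> x = (y + d) mod int n"
    if y: "y \<in> shift_meet n S d" "y \<noteq> x" for y
  proof (rule ccontr)
    assume neg: "\<not> ?thesis"
    have yS: "y \<in> S" using y by (auto simp: shift_meet_def)
    have "(x + d) mod int n \<noteq> (y + d) mod int n"
      using translate_inj[OF xS(1) yS] y(2) by blast
    then have "card {x, y, (x + d) mod int n, (y + d) mod int n} = 4"
      using neg y(2) translate_neq[OF xS(1) d] translate_neq[OF yS d] by auto
    moreover have "sum_rep n S ((x + y + d) mod int n) \<le> 3" by (rule f[OF mod_range])
    ultimately show False using card_translates_le_sum_rep[OF x y(1)] by simp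
  qed
  \<comment> \<open>a pair \<open>(y, y + d)\<close> other than \<open>(x, x + d)\<close> is sent to an element the two share\<close>
  have "card (shift_meet n S d - {x}) \<le> card (midpoints n S d)"
  proof (rule card_inj_on_le[of "\<lambda>y. if y = (x + d) mod int n then y else x"])
    show "inj_on (\<lambda>y. if y = (x + d) mod int n then y else x) (shift_meet n S d - {x})"
    proof (rule inj_onI)
      fix y z
      assume y: "y \<in> shift_meet n S d - {x}" and z: "z \<in> shift_meet n S d - {x}"
        and eq: "(if y = (x + d) mod int n then y else x) = (if z = (x + d) mod int n then z else x)"
      show "y = z"
      proof (cases "y = (x + d) mod int n \<or> z = (x + d) mod int n")
        case True
        then show ?thesis using eq y z by (auto split: if_splits)
      next
        case False
        then have "(y + d) mod int n = (z + d) mod int n"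
          using adj[of y] adj[of z] y z by auto
        then show ?thesis using y z translate_inj by (auto simp: shift_meet_def)
      qed
    qed
    show "(\<lambda>y. if y = (x + d) mod int n then y else x) ` (shift_meet n S d - {x}) \<subseteq> midpoints n S d"
    proof (rule image_subsetI)
      fix y assume y: "y \<in> shift_meet n S d - {x}"
      show "(if y = (x + d) mod int n then y else x) \<in> midpoints n S d"
      proof (cases "y = (x + d) mod int n")
        case True
        then have "(y - d) mod int n = x" using xS by (simp add: mod_simps)
        with True y xS show ?thesis by (auto simp: midpoints_def shift_meet_def)
      next
        case False
        with y adj have "x = (y + d) mod int n" by blast
        then have "(x - d) mod int n = y mod int n" by (simp add: mod_simps)
        then have "(x - d) mod int n = y" using y by (simp add: shift_meet_def)
        with False y xS show ?thesis by (auto simp: midpoints_def shift_meet_def)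
      qed
    qed
  qed (simp add: midpoints_def)
  then show ?thesis using x by (simp add: card_Diff_singleton)
qed simp

text \<open>A middle term \<open>x\<close> gives the representations \<open>(x + d) + (x - d)\<close> of \<open>2 x\<close>. One of the
  \<open>g + 1\<close> possible representations is used up by \<open>d = 0\<close>.\<close>

lemma sum_card_midpoints_le:
  assumes f: "\<And>k. k \<in> {0..<int n} \<Longrightarrow> sum_rep n S k \<le> g + 1"
  shows "(\<Sum>d\<in>{1..<int n}. card (midpoints n S d)) \<le> g * card S"
proof -
  let ?T = "\<lambda>x I. {d \<in> I. (x + d) mod int n \<in> S \<and> (x - d) mod int n \<in> S}"
  have "(\<Sum>d\<in>{1..<int n}. card (midpoints n S d)) = (\<Sum>x\<in>S. card (?T x {1..<int n}))"
    unfolding midpoints_def by (rule sum_multicount_gen) auto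
  also have "\<dots> \<le> (\<Sum>x\<in>S. g)"
  proof (rule sum_mono)
    fix x assume x: "x \<in> S"
    let ?h = "\<lambda>d. ((x + d) mod int n, (x - d) mod int n)"
    have "?T x {0..<int n} = insert 0 (?T x {1..<int n})"
      using x n_pos by auto
    moreover have "finite (?T x {1..<int n})" by (rule finite_subset[of _ "{1..<int n}"]) auto
    ultimately have "card (?T x {1..<int n}) + 1 = card (?T x {0..<int n})" by simp
    also have "\<dots> \<le> card {p \<in> S \<times> S. (fst p + snd p) mod int n = (x + x) mod int n}"
    proof (rule card_inj_on_le[of ?h])
      show "inj_on ?h (?T x {0..<int n})"
      proof (rule inj_onI)
        fix d e assume de: "d \<in> ?T x {0..<int n}" "e \<in> ?T x {0..<int n}" and "?h d = ?h e"
        then have "(x + d) mod int n = (x + e) mod int n" by simp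
        then have "d mod int n = e mod int n" by (simp add: mod_eq_dvd_iff)
        with de show "d = e" by simp
      qed
      show "?h ` ?T x {0..<int n} \<subseteq> {p \<in> S \<times> S. (fst p + snd p) mod int n = (x + x) mod int n}"
        by (auto simp: mod_simps)
    qed simp
    also have "\<dots> \<le> g + 1"
      unfolding sum_rep_eq[OF n_pos, symmetric] by (rule f[OF mod_range])
    finally show "card (?T x {1..<int n}) \<le> g" by simp
  qed
  finally show ?thesis by (simp add: mult.commute)
qed

lemma card_sq_le_of_sum_rep_le_3:
  assumes f: "\<And>k. k \<in> {0..<int n} \<Longrightarrow> sum_rep n S k \<le> 3"
  shows "(card S)\<^sup>2 + 1 \<le> n + 3 * card S"
proof -
  have "(\<Sum>d\<in>{1..<int n}. card (shift_meet n S d)) \<le> (\<Sum>d\<in>{1..<int n}. 1 + card (midpoints n S d))"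
    by (intro sum_mono card_shift_meet_le_midpoints f)
  also have "\<dots> \<le> (n - 1) + 2 * card S"
    unfolding sum.distrib using sum_card_midpoints_le[of 2] f by simp
  finally show ?thesis using sum_card_shift_meet_nonzero n_pos by linarith
qed

end

section \<open>The bounds for the largest sets\<close>

theorem theorem1:
  fixes n :: nat
  assumes "n > 0"
  shows "(int (C 2 n choose 2) \<le> \<lfloor>real n / 2\<rfloor> \<and> real (C 2 n) \<le> sqrt (real n) + 1) \<and>
    real (C 3 n) \<le> sqrt (real n + 9 / 2) + 3 \<and>
    real (C 4 n) \<le> sqrt (3 * real n) + 7 / 6 \<and>
    (\<forall>g::nat. g > 0 \<and> even g \<longrightarrow> real (C g n) \<le> sqrt (real g * real n)) \<and>
    (\<forall>g::nat. g > 0 \<and> odd g \<longrightarrow>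
       real (C g n) \<le> sqrt (1 - 1 / real g) * sqrt (real g * real n) + 1)"
proof -
  have trivial: "real (C g n) \<le> sqrt (real g * real n)" for g
  proof -
    obtain S where S: "S \<subseteq> {0..<int n}" "card S = C g n"
        "\<And>k. k \<in> {0..<int n} \<Longrightarrow> sum_rep n S k \<le> g"
      using C_attained[OF assms] by blast
    interpret residue_set n S by unfold_locales (use assms S in auto)
    have "real ((C g n)\<^sup>2) \<le> real (g * n)"
      using card_sq_le[OF S(3)] S(2) by (simp only: of_nat_le_iff)
    then show ?thesis by (intro real_le_rsqrt) simp
  qed
  have energy: "real (C g n) \<le> sqrt ((real g - 1) * real n) + 1" if "g > 0" for g
  proof -
    obtain S where S: "S \<subseteq> {0..<int n}" "card S = C g n"
        "\<And>k. k \<in> {0..<int n} \<Longrightarrow> sum_rep n S k \<le> g"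
      using C_attained[OF assms] by blast
    interpret residue_set n S by unfold_locales (use assms S in auto)
    have "real (C g n) \<le> sqrt ((real g - 1) * (real n - 1)) + 1"
      using card_le_sqrt_energy[OF S(3) that] S(2) by simp
    also have "\<dots> \<le> sqrt ((real g - 1) * real n) + 1"
      using that by (intro add_right_mono real_sqrt_le_mono mult_left_mono) auto
    finally show ?thesis .
  qed
  have "int (C 2 n choose 2) \<le> \<lfloor>real n / 2\<rfloor>"
  proof -
    obtain S where S: "S \<subseteq> {0..<int n}" "card S = C 2 n"
        "\<And>k. k \<in> {0..<int n} \<Longrightarrow> sum_rep n S k \<le> 2"
      using C_attained[OF assms] by blast
    interpret residue_set n S by unfold_locales (use assms S in auto)
    have "C 2 n choose 2 \<le> n div 2"
      using choose_2_le[OF S(3)] S(2) by simp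
    then show ?thesis
      by (simp add: floor_divide_of_nat_eq[of n 2, simplified])
  qed
  moreover have "real (C 2 n) \<le> sqrt (real n) + 1"
    using energy[of 2] by simp
  moreover have "real (C 3 n) \<le> sqrt (real n + 9 / 2) + 3"
  \<comment> \<open>for \<open>m = C 3 n \<ge> 3\<close>, \<open>(m - 3)\<^sup>2 \<le> m\<^sup>2 - 3 m \<le> n - 1\<close>\<close>
  proof (cases "C 3 n \<le> 3")
    case True
    then have "real (C 3 n) \<le> 3" by simp
    moreover have "0 \<le> sqrt (real n + 9 / 2)" by simp
    ultimately show ?thesis by linarith
  next
    case False
    obtain S where S: "S \<subseteq> {0..<int n}" "card S = C 3 n"
        "\<And>k. k \<in> {0..<int n} \<Longrightarrow> sum_rep n S k \<le> 3"
      using C_attained[OF assms] by blast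
    interpret residue_set n S by unfold_locales (use assms S in auto)
    have "real ((C 3 n)\<^sup>2 + 1) \<le> real (n + 3 * C 3 n)"
      using card_sq_le_of_sum_rep_le_3[OF S(3)] S(2) by (simp only: of_nat_le_iff)
    then have "(real (C 3 n) - 3)\<^sup>2 \<le> real n + 9 / 2"
      using False by (simp add: power2_diff)
    then show ?thesis using real_le_rsqrt by fastforce
  qed
  moreover have "real (C 4 n) \<le> sqrt (3 * real n) + 7 / 6"
    using energy[of 4] by simp
  moreover have "real (C g n) \<le> sqrt (1 - 1 / real g) * sqrt (real g * real n) + 1"
    if "g > 0" for g
  proof -
    have "(1 - 1 / real g) * (real g * real n) = (real g - 1) * real n"
      using that by (simp add: field_simps)
    then have "sqrt (1 - 1 / real g) * sqrt (real g * real n) = sqrt ((real g - 1) * real n)"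
      by (metis real_sqrt_mult)
    then show ?thesis using energy[OF that] by simp
  qed
  ultimately show ?thesis using trivial by blast
qed

end
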